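(* Let $S\subset\mathbb{R}^d$ be a non-empty compact set with $\mathrm{diam}(\mathrm{co}(S))>0$, and let $X_1,X_2,\dots$ be iid random vectors in $\mathbb{R}^d$ whose common distribution has support $S$. Put $\aleph_n=\{X_1,\dots,X_n\}$. Then for every $\gamma>0$, with probability one, for all $n$ large enough, $$|\mathcal{D}(S)-\mathcal{D}(\aleph_n)|\le \frac{3(1+\gamma)\,d_H(S,\aleph_n)}{\mathrm{diam}(\mathrm{co}(S))}.$$
   Context: $\mathbb{R}^d$ carries the Euclidean norm; $\mathrm{co}(A)$ is the convex hull of $A$, $\mathrm{diam}(A)=\sup_{x,y\in A}\|x-y\|$, and $d(x,A)=\inf_{a\in A}\|x-a\|$. For a non-empty compact set $A\subset\mathbb{R}^d$ with $\mathrm{diam}(\mathrm{co}(A))>0$, $$\mathcal{D}(A)=\frac{\sup_{s\in \mathrm{co}(A)}d(s,A)}{\mathrm{diam}(\mathrm{co}(A))}.$$ In particular $\mathcal{D}(\aleph_n)=\sup_{s\in \mathrm{co}(\aleph_n)}d(s,\aleph_n)/\mathrm{diam}(\aleph_n)$, which is defined as soon as $\aleph_n$ contains two distinct points. For non-empty compact $A,C\subset\mathbb{R}^d$, the Hausdorff distance is $d_H(A,C)=\max\{\sup_{a\in A}d(a,C),\ \sup_{c\in C}d(c,A)\}$. *)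

theory Defs
  imports "HOL-Probability.Probability"
begin

definition cover_radius :: "'a::euclidean_space set \<Rightarrow> real" where
  "cover_radius A = (SUP s\<in>convex hull A. infdist s A)"

text \<open>Meaningful for non-empty compact \<open>A\<close> whose convex hull has positive diameter;
  for a singleton the quotient takes the value \<open>0\<close> by the convention \<open>x / 0 = 0\<close>.\<close>
definition hull_defect :: "'a::euclidean_space set \<Rightarrow> real" where
  "hull_defect A = cover_radius A / diameter (convex hull A)"

text \<open>The Hausdorff distance, meaningful for non-empty bounded sets: otherwise the suprema or
  infima involved may be unspecified.\<close>
definition hausdorff_distance :: "'a::metric_space set \<Rightarrow> 'a set \<Rightarrow> real" where
  "hausdorff_distance A C = max (SUP a\<in>A. infdist a C) (SUP c\<in>C. infdist c A)"

text \<open>The topological support of a Borel measure. In a second-countable space it is the smallest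
  closed set whose complement is a null set.\<close>
definition measure_support :: "'a::topological_space measure \<Rightarrow> 'a set" where
  "measure_support \<mu> = {x. \<forall>U. open U \<and> x \<in> U \<longrightarrow> emeasure \<mu> U > 0}"

definition sample_set :: "(nat \<Rightarrow> 'b \<Rightarrow> 'a) \<Rightarrow> nat \<Rightarrow> 'b \<Rightarrow> 'a set" where
  "sample_set X n \<omega> = (\<lambda>i. X i \<omega>) ` {1..n}"

end

theory Submission
  imports Defs
begin

text \<open>Almost surely the sample \<open>A\<close> is a subset of \<open>S\<close> with two distinct points for large \<open>n\<close>, and
  then the bound holds deterministically, even with constant \<open>3\<close>. Put \<open>h = d\<^sub>H(S, A)\<close>. Since
  \<open>A \<subseteq> S\<close> and \<open>co(S)\<close> lies in the closed \<open>h\<close>-neighbourhood of \<open>co(A)\<close>, the covering radii \<open>R\<^sub>S\<close>,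
  \<open>R\<^sub>A\<close> differ by at most \<open>h\<close>, and the hull diameters satisfy \<open>D\<^sub>A \<le> D\<^sub>S \<le> D\<^sub>A + 2h\<close>. Finally
  \<open>R\<^sub>S/D\<^sub>S - R\<^sub>A/D\<^sub>A = (R\<^sub>S - R\<^sub>A)/D\<^sub>S - (R\<^sub>A/D\<^sub>A)(D\<^sub>S - D\<^sub>A)/D\<^sub>S\<close> with \<open>R\<^sub>A \<le> D\<^sub>A\<close>.\<close>

section \<open>Covering radius of a compact set\<close>

lemma infdist_le_diameter_hull:
  fixes A :: "'a::euclidean_space set"
  assumes "compact A" "A \<noteq> {}" "s \<in> convex hull A"
  shows "infdist s A \<le> diameter (convex hull A)"
proof -
  obtain a where a: "a \<in> A" using assms by auto
  have "dist s a \<le> diameter (convex hull A)"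
    using a assms compact_convex_hull compact_imp_bounded hull_inc
    by (metis diameter_bounded_bound)
  then show ?thesis using infdist_le[OF a, of s] by linarith
qed

text \<open>Over an unbounded family the real \<open>SUP\<close> in \<open>cover_radius\<close>
  would be unspecified; the hull diameter serves as a bound, so it is a genuine least upper
  bound.\<close>

lemma bdd_above_infdist_hull:
  fixes A :: "'a::euclidean_space set"
  assumes "compact A" "A \<noteq> {}"
  shows "bdd_above ((\<lambda>s. infdist s A) ` (convex hull A))"
  using infdist_le_diameter_hull[OF assms] by (auto intro!: bdd_aboveI)

lemma cover_radius_upper:
  fixes A :: "'a::euclidean_space set"
  assumes "compact A" "A \<noteq> {}" "s \<in> convex hull A"
  shows "infdist s A \<le> cover_radius A"
  unfolding cover_radius_def by (rule cSUP_upper[OF assms(3) bdd_above_infdist_hull[OF assms(1,2)]])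

lemma cover_radius_least:
  fixes A :: "'a::euclidean_space set"
  assumes "A \<noteq> {}" "\<And>s. s \<in> convex hull A \<Longrightarrow> infdist s A \<le> r"
  shows "cover_radius A \<le> r"
  unfolding cover_radius_def using assms by (intro cSUP_least) auto

lemma cover_radius_nonneg:
  fixes A :: "'a::euclidean_space set"
  assumes "compact A" "A \<noteq> {}"
  shows "cover_radius A \<ge> 0"
  using assms cover_radius_upper[OF assms] hull_inc infdist_nonneg
  by (metis all_not_in_conv order_trans)

section \<open>Hausdorff distance and neighbourhoods\<close>

lemma infdist_le_hausdorff_distance:
  fixes S A :: "'a::metric_space set"
  assumes "bounded S" "A \<noteq> {}" "s \<in> S"
  shows "infdist s A \<le> hausdorff_distance S A"
proof -
  obtain a where a: "a \<in> A" using assms by auto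
  obtain e where e: "\<And>x. x \<in> S \<Longrightarrow> dist a x \<le> e"
    using assms(1) bounded_any_center by blast
  have "infdist x A \<le> e" if "x \<in> S" for x
    using infdist_le[OF a, of x] e[OF that] by (simp add: dist_commute)
  then have "bdd_above ((\<lambda>x. infdist x A) ` S)" by (auto intro!: bdd_aboveI)
  from cSUP_upper[OF assms(3) this] show ?thesis
    unfolding hausdorff_distance_def by linarith
qed

text \<open>Go from \<open>x\<close> to a nearest point of \<open>S\<close>, which exists by
  compactness, and from there to \<open>A\<close>.\<close>

lemma infdist_triangle_uniform:
  fixes S A :: "'a::heine_borel set"
  assumes "compact S" "S \<noteq> {}" "\<And>s. s \<in> S \<Longrightarrow> infdist s A \<le> h"
  shows "infdist x A \<le> infdist x S + h"
proof -
  obtain s where s: "s \<in> S" "infdist x S = dist x s"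
    using infdist_attains_inf[OF compact_imp_closed[OF assms(1)] assms(2)] by blast
  then show ?thesis using infdist_triangle[of x A s] assms(3)[OF s(1)] by linarith
qed

text \<open>The closed \<open>h\<close>-neighbourhood of \<open>convex hull A\<close> is its
  Minkowski sum with a ball, hence convex; it contains \<open>S\<close>, and therefore the whole
  hull of \<open>S\<close>.\<close>

lemma hull_point_approx:
  fixes S A :: "'a::euclidean_space set"
  assumes A: "compact A" "A \<noteq> {}" and h: "\<And>s. s \<in> S \<Longrightarrow> infdist s A \<le> h"
    and x: "x \<in> convex hull S"
  obtains y where "y \<in> convex hull A" "dist x y \<le> h"
proof -
  let ?T = "\<Union>u\<in>convex hull A. \<Union>v\<in>cball 0 h. {u + v}"
  have "S \<subseteq> ?T"
  proof
    fix s assume s: "s \<in> S"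
    obtain a where a: "a \<in> A" "infdist s A = dist s a"
      using infdist_attains_inf[OF compact_imp_closed[OF A(1)] A(2)] by blast
    have "s = a + (s - a)" "s - a \<in> cball 0 h" "a \<in> convex hull A"
      using h[OF s] a hull_inc[OF a(1)] by (auto simp: dist_norm norm_minus_commute)
    then show "s \<in> ?T" by blast
  qed
  moreover have "convex ?T" by (rule convex_sums) (auto simp: convex_convex_hull)
  ultimately have "convex hull S \<subseteq> ?T" by (rule hull_minimal)
  with x obtain u v where "u \<in> convex hull A" "norm v \<le> h" "x = u + v" by auto
  then show ?thesis by (intro that[of u]) (auto simp: dist_norm)
qed

section \<open>Deterministic comparison of the two defects\<close>

lemma abs_hull_defect_diff_le:
  fixes S A :: "'a::euclidean_space set"
  assumes S: "compact S" and A: "compact A" "A \<noteq> {}" and sub: "A \<subseteq> S"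
    and pos: "diameter (convex hull A) > 0"
  shows "\<bar>hull_defect S - hull_defect A\<bar>
    \<le> 3 * hausdorff_distance S A / diameter (convex hull S)"
proof -
  define h where "h = hausdorff_distance S A"
  define DS where "DS = diameter (convex hull S)"
  define DA where "DA = diameter (convex hull A)"
  define RS where "RS = cover_radius S"
  define RA where "RA = cover_radius A"
  note defs = h_def DS_def DA_def RS_def RA_def
  have S0: "S \<noteq> {}" using A sub by auto
  have h: "infdist s A \<le> h" if "s \<in> S" for s
    unfolding h_def using infdist_le_hausdorff_distance[OF compact_imp_bounded[OF S] A(2) that] .
  have hull_sub: "convex hull A \<subseteq> convex hull S" by (rule hull_mono[OF sub])
  have bS: "bounded (convex hull S)" and bA: "bounded (convex hull A)"
    using S A compact_convex_hull compact_imp_bounded by blast+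
  have D1: "DA \<le> DS" unfolding defs by (rule diameter_subset[OF hull_sub bS])
  \<comment> \<open>Each of the two endpoints of a segment in the hull of \<open>S\<close> moves by
    at most \<open>h\<close> to reach the hull of \<open>A\<close>.\<close>
  have D2: "DS \<le> DA + 2 * h"
    unfolding DS_def
  proof (rule diameter_le)
    show "convex hull S \<noteq> {} \<or> 0 \<le> DA + 2 * h" using S0 by simp
    fix x y assume "x \<in> convex hull S" "y \<in> convex hull S"
    then obtain x' y' where x': "x' \<in> convex hull A" "dist x x' \<le> h"
      and y': "y' \<in> convex hull A" "dist y y' \<le> h"
      using hull_point_approx[OF A h] by metis
    have "dist x' y' \<le> DA"
      unfolding DA_def by (rule diameter_bounded_bound[OF bA x'(1) y'(1)])
    moreover have "dist x y \<le> dist x x' + dist x' y' + dist y' y"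
      using dist_triangle[of x y x'] dist_triangle[of x' y y'] by linarith
    ultimately show "norm (x - y) \<le> DA + 2 * h"
      using x' y' by (simp add: dist_norm norm_minus_commute)
  qed
  have R1: "RS \<le> RA + h"
    unfolding RS_def
  proof (rule cover_radius_least[OF S0])
    fix s assume "s \<in> convex hull S"
    then obtain s' where s': "s' \<in> convex hull A" "dist s s' \<le> h"
      using hull_point_approx[OF A h] by metis
    \<comment> \<open>Passing from \<open>S\<close> to the smaller target \<open>A\<close> only
      increases the distance; the cost \<open>h\<close> comes from moving \<open>s\<close> to
      \<open>s'\<close>, as the distance to \<open>A\<close> is 1-Lipschitz.\<close>
    have "infdist s S \<le> infdist s A" by (rule infdist_mono[OF sub A(2)])
    also have "\<dots> \<le> infdist s' A + dist s s'" by (rule infdist_triangle)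
    also have "\<dots> \<le> RA + h"
      unfolding RA_def using cover_radius_upper[OF A s'(1)] s'(2) by linarith
    finally show "infdist s S \<le> RA + h" .
  qed
  have R2: "RA \<le> RS + h"
    unfolding RA_def
  proof (rule cover_radius_least[OF A(2)])
    \<comment> \<open>Here \<open>s\<close> stays fixed, lying in the larger hull already; the cost
      \<open>h\<close> comes from replacing the target \<open>S\<close> by \<open>A\<close>.\<close>
    fix s assume "s \<in> convex hull A"
    then have "infdist s S \<le> RS"
      unfolding RS_def using cover_radius_upper[OF S S0] hull_sub by blast
    then show "infdist s A \<le> RS + h"
      using infdist_triangle_uniform[OF S S0 h, of s] by linarith
  qed
  have RA: "0 \<le> RA" "RA \<le> DA"
    unfolding defs
    using cover_radius_nonneg[OF A] cover_radius_least[OF A(2) infdist_le_diameter_hull[OF A]]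
    by auto
  have DA: "DA > 0" using pos by (simp add: DA_def)
  have DS: "DS > 0" using DA D1 by linarith
  \<comment> \<open>\<open>t\<close> carries the effect of changing the denominator. Since
    \<open>RA / DA\<close> lies in [0, 1], \<open>t\<close> lies between 0 and
    \<open>DS - DA\<close>, which is at most \<open>2 * h\<close>; the radii contribute the third
    \<open>h\<close>.\<close>
  define t where "t = RA / DA * (DS - DA)"
  have eq: "RS / DS - RA / DA = (RS - RA - t) / DS"
    using DA DS by (simp add: t_def field_simps)
  have "0 \<le> t" unfolding t_def using RA DA D1 by simp
  moreover have "t \<le> DS - DA"
    using mult_right_mono[of "RA / DA" 1 "DS - DA"] RA DA D1 by (simp add: t_def)
  ultimately have "\<bar>RS - RA - t\<bar> \<le> 3 * h" using R1 R2 D2 by linarith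
  then have "\<bar>RS / DS - RA / DA\<bar> \<le> 3 * h / DS"
    unfolding eq abs_divide using DS by (simp add: divide_right_mono)
  then show ?thesis by (simp add: hull_defect_def defs)
qed

section \<open>Almost sure behaviour of the sample\<close>

lemma AE_in_measure_support:
  fixes \<mu> :: "'a::second_countable_topology measure"
  assumes "sets \<mu> = sets borel"
  shows "AE x in \<mu>. x \<in> measure_support \<mu>"
proof -
  \<comment> \<open>The complement of the support is the union of all open null sets; Lindelof's
    theorem reduces it to a countable union, which is null.\<close>
  let ?F = "{U. open U \<and> emeasure \<mu> U = 0}"
  obtain F' where F': "F' \<subseteq> ?F" "countable F'" "\<Union>F' = \<Union>?F"
    using Lindelof[of ?F] by auto
  have "U \<in> null_sets \<mu>" if "U \<in> F'" for U
    using that F'(1) assms by (auto simp: null_sets_def)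
  then have "\<Union>F' \<in> null_sets \<mu>"
    using null_sets_UN'[OF F'(2), of "\<lambda>U. U"] by simp
  moreover have "{x \<in> space \<mu>. x \<notin> measure_support \<mu>} \<subseteq> \<Union>F'"
    unfolding F'(3) by (auto simp: measure_support_def zero_less_iff_neq_zero)
  ultimately show ?thesis by (rule AE_I')
qed

text \<open>By independence the first \<open>n\<close> variables all miss \<open>U\<close> with
  probability \<open>q ^ n\<close>, where \<open>q < 1\<close> because \<open>U\<close> has positive
  mass; letting \<open>n\<close> grow, the event of never visiting \<open>U\<close> is null.\<close>

lemma (in prob_space) AE_iid_visits:
  assumes indep: "indep_vars (\<lambda>_. N) X {1..}"
    and distr: "\<And>i. i \<ge> 1 \<Longrightarrow> distr M N (X i) = \<mu>"
    and U: "U \<in> sets N" "emeasure \<mu> U > 0"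
  shows "AE \<omega> in M. \<exists>i\<ge>1::nat. X i \<omega> \<in> U"
proof -
  have rv: "random_variable N (X i)" if "i \<ge> 1" for i
    using indep that by (auto simp: indep_vars_def)
  define V where "V = space N - U"
  have V: "V \<in> sets N" unfolding V_def using U by auto
  let ?E = "\<lambda>i. X i -` V \<inter> space M"
  have E: "?E i \<in> events" if "i \<ge> 1" for i
    using rv[OF that] V by (rule measurable_sets)
  define q where "q = prob (?E 1)"
  have q_eq: "prob (?E i) = q" if "i \<ge> 1" for i
    unfolding q_def
    using measure_distr[OF rv[OF that] V] measure_distr[OF rv[of 1] V] distr[OF that] distr[of 1]
    by simp
  have "emeasure M (X 1 -` U \<inter> space M) > 0"
    using U(2) distr[of 1] emeasure_distr[OF rv[of 1] U(1)] by simp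
  then have "prob (X 1 -` U \<inter> space M) > 0"
    by (simp add: emeasure_eq_measure)
  moreover have "?E 1 = space M - (X 1 -` U \<inter> space M)"
    unfolding V_def using measurable_space[OF rv[of 1]] by auto
  moreover have "X 1 -` U \<inter> space M \<in> events" using rv[of 1] U by (simp add: measurable_sets)
  ultimately have q1: "q < 1" unfolding q_def by (simp add: prob_compl)
  define B where "B = (\<Inter>i\<in>{1..}. ?E i)"
  have B: "B \<in> events" unfolding B_def using E by (intro sets.countable_INT) auto
  \<comment> \<open>The condition on \<open>n\<close> keeps the index set \<open>{1..n}\<close>
    non-empty, as the finite intersection and the product formula require.\<close>
  have le: "prob B \<le> q ^ n" if "n \<ge> 1" for n
  proof -
    have "prob B \<le> prob (\<Inter>i\<in>{1..n}. ?E i)"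
      using that E by (intro finite_measure_mono sets.finite_INT) (auto simp: B_def)
    also have "\<dots> = (\<Prod>i\<in>{1..n}. prob (?E i))"
      using that V by (intro indep_varsD[OF indep]) auto
    also have "\<dots> = q ^ n" by (simp add: q_eq)
    finally show ?thesis .
  qed
  have "(\<lambda>n. q ^ n) \<longlonglongrightarrow> 0"
    using q1 by (intro LIMSEQ_power_zero) (simp add: q_def)
  then have "prob B \<le> 0"
    using le by (intro LIMSEQ_le_const) auto
  then have "B \<in> null_sets M"
    using B by (auto simp: emeasure_eq_measure measure_le_0_iff intro!: null_setsI)
  moreover have "{\<omega> \<in> space M. \<not> (\<exists>i\<ge>1. X i \<omega> \<in> U)} \<subseteq> B"
    unfolding B_def V_def using measurable_space[OF rv] by fastforce
  ultimately show ?thesis by (rule AE_I')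
qed

theorem theorem4p1:
  fixes S :: "(real ^ 'd) set"
    and M :: "'b measure"
    and X :: "nat \<Rightarrow> 'b \<Rightarrow> real ^ 'd"
    and \<mu> :: "(real ^ 'd) measure"
    and \<gamma> :: real
  assumes "S \<noteq> {}" and "compact S" and "diameter (convex hull S) > 0"
    and "prob_space M"
    and "prob_space.indep_vars M (\<lambda>_. borel) X {1..}"
    and "\<And>i. i \<ge> 1 \<Longrightarrow> distr M borel (X i) = \<mu>"
    and "measure_support \<mu> = S"
    and "\<gamma> > 0"
  shows "AE \<omega> in M. \<forall>\<^sub>F n in sequentially.
           diameter (convex hull (sample_set X n \<omega>)) > 0 \<and>
           \<bar>hull_defect S - hull_defect (sample_set X n \<omega>)\<bar>
             \<le> 3 * (1 + \<gamma>) * hausdorff_distance S (sample_set X n \<omega>) / diameter (convex hull S)"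
proof -
  interpret prob_space M by (rule assms(4))
  have rv: "random_variable borel (X i)" if "i \<ge> 1" for i
    using assms(5) that by (auto simp: indep_vars_def)
  have sets_\<mu>: "sets \<mu> = sets borel" using assms(6)[of 1] by auto
  \<comment> \<open>A singleton has hull diameter 0, so \<open>S\<close> has two distinct
    points.\<close>
  obtain x y where xy: "x \<in> S" "y \<in> S" "x \<noteq> y"
  proof -
    have "\<not> S \<subseteq> {x}" for x
    proof
      assume "S \<subseteq> {x}"
      then have "S = {x}" using assms(1) by auto
      then show False using assms(3) by simp
    qed
    then show ?thesis using assms(1) that by blast
  qed
  \<comment> \<open>Disjointness ensures that visits to \<open>U\<close> and to \<open>V\<close>
    yield two distinct sample points.\<close>
  obtain U V where UV: "open U" "open V" "x \<in> U" "y \<in> V" "U \<inter> V = {}"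
    using hausdorff[OF xy(3)] by blast
  have pos: "emeasure \<mu> U > 0" "emeasure \<mu> V > 0"
    using xy UV assms(7) by (auto simp: measure_support_def)
  have hitU: "AE \<omega> in M. \<exists>i\<ge>1. X i \<omega> \<in> U" and hitV: "AE \<omega> in M. \<exists>i\<ge>1. X i \<omega> \<in> V"
    using AE_iid_visits[OF assms(5,6), of U] AE_iid_visits[OF assms(5,6), of V] UV pos by auto
  have inS: "AE \<omega> in M. \<forall>i\<in>{1..}. X i \<omega> \<in> S"
  proof (rule AE_ball_countable')
    fix i :: nat assume i: "i \<in> {1..}"
    have "AE x in distr M borel (X i). x \<in> S"
      using AE_in_measure_support[OF sets_\<mu>] i
      by (subst assms(6)) (simp_all add: assms(7))
    then show "AE \<omega> in M. X i \<omega> \<in> S"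
      \<comment> \<open>Pulling the statement back from the distribution to \<open>M\<close> needs
        \<open>S\<close> to be Borel, which compactness gives.\<close>
      using rv i assms(2) by (subst (asm) AE_distr_iff) (auto simp: borel_compact)
  qed auto
  show ?thesis
    using hitU hitV inS
  proof eventually_elim
    fix \<omega>
    assume "\<exists>i\<ge>1. X i \<omega> \<in> U" "\<exists>i\<ge>1. X i \<omega> \<in> V" and S: "\<forall>i\<in>{1..}. X i \<omega> \<in> S"
    then obtain i j where ij: "i \<ge> 1" "X i \<omega> \<in> U" "j \<ge> 1" "X j \<omega> \<in> V" by blast
    show "\<forall>\<^sub>F n in sequentially.
           diameter (convex hull (sample_set X n \<omega>)) > 0 \<and>
           \<bar>hull_defect S - hull_defect (sample_set X n \<omega>)\<bar>
             \<le> 3 * (1 + \<gamma>) * hausdorff_distance S (sample_set X n \<omega>) / diameter (convex hull S)"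
      \<comment> \<open>From this index on the sample contains both separated points.\<close>
      using eventually_ge_at_top[of "max i j"]
    proof eventually_elim
      fix n assume n: "max i j \<le> n"
      let ?A = "sample_set X n \<omega>"
      have A: "compact ?A" unfolding sample_set_def by (intro finite_imp_compact) auto
      have sub: "?A \<subseteq> S" unfolding sample_set_def using S by auto
      have mem: "X i \<omega> \<in> ?A" "X j \<omega> \<in> ?A" unfolding sample_set_def using ij n by auto
      have bA: "bounded (convex hull ?A)"
        using A compact_convex_hull compact_imp_bounded by blast
      have "0 < dist (X i \<omega>) (X j \<omega>)" using ij UV(5) by auto
      also have "\<dots> \<le> diameter (convex hull ?A)"
        using mem by (intro diameter_bounded_bound[OF bA]) (auto intro: hull_inc)
      finally have D: "diameter (convex hull ?A) > 0" .
      \<comment> \<open>Nonnegativity is what allows the constant 3 to be enlarged to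
        \<open>3 * (1 + \<gamma>)\<close>.\<close>
      have "0 \<le> hausdorff_distance S ?A"
        using infdist_le_hausdorff_distance[OF compact_imp_bounded[OF assms(2)] _ xy(1), of ?A]
          infdist_nonneg[of x ?A] mem by force
      then have "3 * hausdorff_distance S ?A \<le> 3 * (1 + \<gamma>) * hausdorff_distance S ?A"
        using assms(8) by (simp add: distrib_right distrib_left)
      then have "3 * hausdorff_distance S ?A / diameter (convex hull S)
          \<le> 3 * (1 + \<gamma>) * hausdorff_distance S ?A / diameter (convex hull S)"
        using assms(3) by (intro divide_right_mono) auto
      moreover have "\<bar>hull_defect S - hull_defect ?A\<bar>
          \<le> 3 * hausdorff_distance S ?A / diameter (convex hull S)"
        using abs_hull_defect_diff_le[OF assms(2) A _ sub D] mem by auto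
      ultimately show "diameter (convex hull ?A) > 0 \<and> \<bar>hull_defect S - hull_defect ?A\<bar>
          \<le> 3 * (1 + \<gamma>) * hausdorff_distance S ?A / diameter (convex hull S)"
        using D by linarith
    qed
  qed
qed

end
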